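(* Let $\langle\phi,\vec a\rangle$ be a loop with $\phi(\vec x)\equiv\bigwedge_{i=1}^k C_i$ in CNF, where each clause $C_i$ contains an inequation $e_i(\vec x)>0$ (as one of its disjuncts) such that \[ e_i(\vec x)\le e_i(\vec a(\vec x))\implies e_i(\vec a(\vec x))\le e_i(\vec a^2(\vec x)) \] is valid. Then the formula \[ \vec x'=\vec a^n(\vec x)\land\bigwedge_{i=1}^k 0<e_i(\vec x)\le e_i(\vec a(\vec x)) \] approximates $\langle\phi,\vec a\rangle$.
   Context: Fix $d\ge 1$, integer variables $\vec x=(x_1,\dots,x_d)$, $\vec x'$, and $n$ ranging over $\mathbb N$. A loop $\langle\phi,\vec a\rangle$ consists of a quantifier-free formula $\phi$ over atoms $p>0$ ($p$ an arithmetic expression over $\vec x$, integer semantics) and a map $\vec a:\mathbb Z^d\to\mathbb Z^d$ given by expressions over $\vec x$; $\vec a^m$ is $m$-fold application. $\vec x\longrightarrow_{\langle\phi,\vec a\rangle}\vec x'$ iff $\phi(\vec x)\land\vec x'=\vec a(\vec x)$, and $\longrightarrow^m$ is its $m$-fold composition. A formula $\psi$ over $(\vec x,n,\vec x')$ approximates the loop if for all $\vec x,\vec x'\in\mathbb Z^d$ and $n>0$, $\psi$ implies $\vec x\longrightarrow^n_{\langle\phi,\vec a\rangle}\vec x'$. Validity means truth for all integer values of the free variables. *)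

theory Defs
  imports "HOL-Analysis.Finite_Cartesian_Product"
begin

text \<open>
  The language of arithmetic expressions over the variables \<open>x\<^sub>1, \<dots>, x\<^sub>d\<close> is a parameter: a type \<open>'e\<close>
  of expressions together with their integer semantics \<open>ev :: 'e \<Rightarrow> int ^ 'd \<Rightarrow> int\<close>.
  Polynomials, exponentials, integer division and so on are all instances.  The index type \<open>'d\<close> is
  finite and nonempty, so the dimension \<open>CARD('d)\<close> is an arbitrary positive number.
\<close>

text \<open>\<open>Gt0 p\<close> is the atom \<open>p > 0\<close>; \<open>And []\<close> is true and \<open>Or []\<close> is false.\<close>

datatype 'e fm = Gt0 'e | Neg "'e fm" | And "'e fm list" | Or "'e fm list"

fun holds :: "('e \<Rightarrow> int ^ 'd \<Rightarrow> int) \<Rightarrow> 'e fm \<Rightarrow> int ^ 'd \<Rightarrow> bool" where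
  "holds ev (Gt0 p) x \<longleftrightarrow> ev p x > 0"
| "holds ev (Neg f) x \<longleftrightarrow> \<not> holds ev f x"
| "holds ev (And fs) x \<longleftrightarrow> (\<forall>f\<in>set fs. holds ev f x)"
| "holds ev (Or fs) x \<longleftrightarrow> (\<exists>f\<in>set fs. holds ev f x)"

fun literal :: "'e fm \<Rightarrow> bool" where
  "literal (Gt0 p) \<longleftrightarrow> True"
| "literal (Neg (Gt0 p)) \<longleftrightarrow> True"
| "literal _ \<longleftrightarrow> False"

definition update :: "('e \<Rightarrow> int ^ 'd \<Rightarrow> int) \<Rightarrow> 'e ^ 'd \<Rightarrow> int ^ 'd \<Rightarrow> int ^ 'd" where
  "update ev a x = (\<chi> j. ev (a $ j) x)"

type_synonym ('e, 'd) loop = "'e fm \<times> ('e ^ 'd)"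

definition step :: "('e \<Rightarrow> int ^ 'd \<Rightarrow> int) \<Rightarrow> ('e, 'd) loop \<Rightarrow> int ^ 'd \<Rightarrow> int ^ 'd \<Rightarrow> bool" where
  "step ev l x x' \<longleftrightarrow> holds ev (fst l) x \<and> x' = update ev (snd l) x"

text \<open>
  A formula over \<open>(x, n, x')\<close> is given by its truth value, since \<open>a\<^sup>n(x)\<close> with symbolic \<open>n\<close> need not
  be an expression of the language.
\<close>

definition approximates ::
    "('e \<Rightarrow> int ^ 'd \<Rightarrow> int) \<Rightarrow> (int ^ 'd \<Rightarrow> nat \<Rightarrow> int ^ 'd \<Rightarrow> bool) \<Rightarrow> ('e, 'd) loop \<Rightarrow> bool" where
  "approximates ev \<psi> l \<longleftrightarrow> (\<forall>x x' n. n > 0 \<longrightarrow> \<psi> x n x' \<longrightarrow> (step ev l ^^ n) x x')"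

end

theory Submission
  imports Defs
begin

text \<open>
  Once \<open>e\<^sub>i\<close> does not decrease along one step of \<open>a\<close>, the implication keeps it from decreasing along
  the next one.  Hence \<open>e\<^sub>i\<close> is monotone along the whole orbit and stays positive there, so that one
  disjunct of every clause holds at each iterate.
\<close>

text \<open>Both conjuncts go through one induction: the inequality at an iterate passes positivity
  on to the next, and \<open>mono\<close> there renews the inequality.\<close>

lemma eventually_increasing_orbit:
  fixes g :: "'a \<Rightarrow> 'b :: {linorder, zero}"
  assumes mono: "\<And>x. g x \<le> g (f x) \<Longrightarrow> g (f x) \<le> g (f (f x))"
    and "0 < g x" "g x \<le> g (f x)"
  shows "0 < g ((f ^^ m) x) \<and> g ((f ^^ m) x) \<le> g (f ((f ^^ m) x))"
proof (induction m)
  case 0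
  then show ?case using assms by simp
next
  case (Suc m)
  then show ?case using mono[of "(f ^^ m) x"] by auto
qed

text \<open>Since \<open>update ev a\<close> is a total function, only the guard can block a run. It
  is tested before each step, never at the final state, hence \<open>m < n\<close>.\<close>

lemma relpowp_step_if_guard_on_orbit:
  assumes "\<And>m. m < n \<Longrightarrow> holds ev \<phi> ((update ev a ^^ m) x)"
  shows "(step ev (\<phi>, a) ^^ n) x ((update ev a ^^ n) x)"
  using assms
proof (induction n)
  case 0
  then show ?case by simp
next
  case (Suc n)
  have "step ev (\<phi>, a) ((update ev a ^^ n) x) ((update ev a ^^ Suc n) x)"
    using Suc.prems by (simp add: step_def)
  \<comment> \<open>The new step is appended at the end of the run, so the start \<open>x\<close>
    stays fixed in the induction.\<close>
  with Suc show ?case by (meson less_SucI relpowp_Suc_I)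
qed

theorem theorem12:
  fixes ev :: "'e \<Rightarrow> int ^ 'd \<Rightarrow> int"
    and \<phi> :: "'e fm" and a :: "'e ^ 'd"
    and k :: nat and C :: "nat \<Rightarrow> 'e fm list" and e :: "nat \<Rightarrow> 'e"
  assumes "\<phi> = And (map (\<lambda>i. Or (C i)) [1..<Suc k])"
    and "\<And>i. i \<in> {1..k} \<Longrightarrow> \<forall>l\<in>set (C i). literal l"
    and "\<And>i. i \<in> {1..k} \<Longrightarrow> Gt0 (e i) \<in> set (C i)"
    and "\<And>i x. i \<in> {1..k} \<Longrightarrow>
           ev (e i) x \<le> ev (e i) (update ev a x) \<longrightarrow>
           ev (e i) (update ev a x) \<le> ev (e i) ((update ev a ^^ 2) x)"
  shows "approximates ev
           (\<lambda>x n x'. x' = (update ev a ^^ n) x \<and>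
              (\<forall>i\<in>{1..k}. 0 < ev (e i) x \<and> ev (e i) x \<le> ev (e i) (update ev a x)))
           (\<phi>, a)"
  unfolding approximates_def
proof (intro allI impI)
  fix x x' :: "int ^ 'd" and n :: nat
  assume init: "x' = (update ev a ^^ n) x \<and>
    (\<forall>i\<in>{1..k}. 0 < ev (e i) x \<and> ev (e i) x \<le> ev (e i) (update ev a x))"
  have "holds ev \<phi> ((update ev a ^^ m) x)" for m
  proof -
    have "holds ev (Or (C i)) ((update ev a ^^ m) x)" if i: "i \<in> {1..k}" for i
    proof -
      have "0 < ev (e i) ((update ev a ^^ m) x)"
        using eventually_increasing_orbit[of "ev (e i)" "update ev a" x m] init assms(4) i
        by (simp add: numeral_2_eq_2)
      then have "holds ev (Gt0 (e i)) ((update ev a ^^ m) x)" by simp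
      with assms(3)[OF i] show ?thesis unfolding holds.simps(4) by blast
    qed
    \<comment> \<open>Without \<open>upt_Suc\<close> the list \<open>[1..<Suc k]\<close> stays
      whole, and its set is the index range \<open>{1..k}\<close>.\<close>
    then show ?thesis
      unfolding assms(1) by (auto simp del: upt_Suc)
  qed
  then show "(step ev (\<phi>, a) ^^ n) x x'"
    using init relpowp_step_if_guard_on_orbit by blast
qed

end
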